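(* Let $X$ be a $W$-hyperbolic space, $C\subseteq X$ a convex subset, and $(T_n:X\to X)_{n\in\mathbb{N}}$ a family of self-mappings of $X$ that have common fixed points, i.e. $F:=\bigcap_{n\in\mathbb{N}}\operatorname{Fix}(T_n)\neq\emptyset$. Let $\alpha_n=1-\frac{2}{n+2}$ and $\gamma_n=\frac{n+2}{n+1}$ for all $n\in\mathbb{N}$, and suppose that for all $y\in X$ and all $n,m\in\mathbb{N}$, $$d(T_ny,T_my)\le\frac{|\gamma_n-\gamma_m|}{\gamma_n}\,d(y,T_ny).$$ Let $x,u\in C$ and let $(x_n)$ be defined by $$x_0=x,\qquad x_{n+1}=(1-\alpha_n)u+\alpha_nT_nx_n\quad(n\in\mathbb{N}).$$ Let $p\in F$ and let $M\in\mathbb{N}^*$ be such that $M\ge\max\{d(x,p),d(u,p)\}$. Then for all $m,n\in\mathbb{N}$, $$d(x_{n+1},x_n)\le\frac{6M}{n+2},\qquad d(x_n,T_nx_n)\le\frac{10M}{n+2},\qquad d(x_n,T_mx_n)\le\frac{20M}{n+2}.$$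
   Context: $\mathbb{N}=\{0,1,2,\dots\}$ and $\mathbb{N}^*=\mathbb{N}\setminus\{0\}$. A $W$-hyperbolic space is a metric space $(X,d)$ together with a function $W:X\times X\times[0,1]\to X$, where one writes $(1-\lambda)x+\lambda y$ for $W(x,y,\lambda)$, such that for all $x,y,z,w\in X$ and $\lambda,\tilde\lambda\in[0,1]$: (W1) $d(z,W(x,y,\lambda))\le(1-\lambda)d(z,x)+\lambda d(z,y)$; (W2) $d(W(x,y,\lambda),W(x,y,\tilde\lambda))=|\lambda-\tilde\lambda|d(x,y)$; (W3) $W(x,y,\lambda)=W(y,x,1-\lambda)$; (W4) $d(W(x,z,\lambda),W(y,w,\lambda))\le(1-\lambda)d(x,y)+\lambda d(z,w)$. A nonempty subset $C\subseteq X$ is convex if $(1-\lambda)x+\lambda y\in C$ for all $x,y\in C$ and $\lambda\in[0,1]$. For a mapping $S:X\to X$, $\operatorname{Fix}(S)$ is its set of fixed points.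
   Formalization: Every T_n is additionally assumed nonexpansive on X; without this the claim fails, e.g. X=C=ℝ, T_n y=100y, p=0, x=u=1, M=1 gives d(x_2,x_1)=33>2. *)

theory Defs
  imports "HOL-Analysis.Lipschitz"
begin

text \<open>The metric space \<open>X\<close> is the type \<open>'a\<close>; \<open>W x y l\<close> stands for \<open>(1 - l) x + l y\<close>.
  It is total in \<open>l\<close>, but nothing is assumed about its values for \<open>l\<close> outside \<open>{0..1}\<close>.\<close>

locale w_hyperbolic =
  fixes W :: "'a::metric_space \<Rightarrow> 'a \<Rightarrow> real \<Rightarrow> 'a"
  assumes W1: "l \<in> {0..1} \<Longrightarrow> dist z (W x y l) \<le> (1 - l) * dist z x + l * dist z y"
    and W2: "l \<in> {0..1} \<Longrightarrow> l' \<in> {0..1} \<Longrightarrow> dist (W x y l) (W x y l') = \<bar>l - l'\<bar> * dist x y"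
    and W3: "l \<in> {0..1} \<Longrightarrow> W x y l = W y x (1 - l)"
    and W4: "l \<in> {0..1} \<Longrightarrow> dist (W x z l) (W y w l) \<le> (1 - l) * dist x y + l * dist z w"

definition w_convex :: "('a \<Rightarrow> 'a \<Rightarrow> real \<Rightarrow> 'a) \<Rightarrow> 'a set \<Rightarrow> bool" where
  "w_convex W C \<longleftrightarrow> C \<noteq> {} \<and> (\<forall>x\<in>C. \<forall>y\<in>C. \<forall>l\<in>{0..1}. W x y l \<in> C)"

definition Fix :: "('a \<Rightarrow> 'a) \<Rightarrow> 'a set" where
  "Fix S = {x. S x = x}"

end

theory Submission
  imports Defs
begin

text \<open>With \<open>d n = dist (xs (Suc n)) (xs n)\<close>, the orbit stays in the ball of radius \<open>M\<close> around \<open>p\<close>, so (W4),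
  (W2) and the hypothesis on the \<open>T n\<close> give
  \<open>d (n+1) \<le> (n+1)/(n+3) * (d n + 2M/(n+2)\<^sup>2) + 4M/((n+2)(n+3))\<close>.
  The bound \<open>6M/(n+2)\<close> propagates through this recursion, and the other two follow by triangle
  inequalities.\<close>

context w_hyperbolic
begin

text \<open>Passes through \<open>W u z l\<close>: (W4) pays for moving the endpoint at a fixed
  parameter, (W2) for moving the parameter. It is meant for two consecutive iterates, which share
  the anchor \<open>u\<close>.\<close>

lemma dist_W_same_left_le:
  assumes "l \<in> {0..1}" "l' \<in> {0..1}"
  shows "dist (W u y l) (W u z l') \<le> l * dist y z + \<bar>l - l'\<bar> * dist u z"
proof -
  have "dist (W u y l) (W u z l) \<le> l * dist y z"
    using W4[OF assms(1), of u y u z] by simp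
  then show ?thesis
    using W2[OF assms, of u z] dist_triangle[of "W u y l" "W u z l'" "W u z l"] by linarith
qed

lemma dist_W_right_le:
  assumes "l \<in> {0..1}"
  shows "dist (W x y l) y \<le> (1 - l) * dist x y"
  using W1[OF assms, of y x y] by (simp add: dist_commute)

lemma dist_W_le:
  assumes "l \<in> {0..1}" "dist x p \<le> r" "dist y p \<le> r"
  shows "dist (W x y l) p \<le> r"
proof -
  have "dist p (W x y l) \<le> (1 - l) * dist p x + l * dist p y"
    by (rule W1[OF assms(1)])
  also have "\<dots> \<le> r"
    using assms by (intro convex_bound_le) (auto simp: dist_commute)
  finally show ?thesis by (simp add: dist_commute)
qed

end

text \<open>The induction step for the rate, isolated as real arithmetic. Over the denominator
  (n+2)(n+3) the three terms contribute 6M(n+1), at most 2M, and 4M, which add up to at most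
  6M(n+2). The constant 6 is thus the total 2 + 4 of the two perturbations.\<close>

lemma linear_rate_step:
  fixes n M d e :: real
  assumes "n \<ge> 0" "M \<ge> 0" "d \<le> 6 * M / (n + 2)"
    and "e \<le> (n + 1) / (n + 3) * (d + 2 * M / (n + 2)\<^sup>2) + 4 * M / ((n + 2) * (n + 3))"
  shows "e \<le> 6 * M / (n + 3)"
proof -
  \<comment> \<open>One factor n+2 is weakened to n+1 so that it cancels against the coefficient
    (n+1)/(n+3).\<close>
  have "2 * M / (n + 2)\<^sup>2 \<le> 2 * M / ((n + 1) * (n + 2))"
    using assms by (intro divide_left_mono) (auto simp: power2_eq_square mult_right_mono)
  then have "(n + 1) / (n + 3) * (d + 2 * M / (n + 2)\<^sup>2)
      \<le> (n + 1) / (n + 3) * (6 * M / (n + 2) + 2 * M / ((n + 1) * (n + 2)))"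
    using assms by (intro mult_left_mono add_mono) auto
  moreover have "(n + 1) / (n + 3) * (6 * M / (n + 2) + 2 * M / ((n + 1) * (n + 2)))
      + 4 * M / ((n + 2) * (n + 3)) = 6 * M / (n + 3)"
  proof -
    have "n + 1 \<noteq> 0" "n + 2 \<noteq> 0" "n + 3 \<noteq> 0" using assms(1) by auto
    then show ?thesis by (simp add: divide_simps) (simp add: algebra_simps)
  qed
  ultimately show ?thesis using assms(4) by linarith
qed

theorem proposition3p9:
  fixes W :: "'a::metric_space \<Rightarrow> 'a \<Rightarrow> real \<Rightarrow> 'a"
    and C :: "'a set"
    and T :: "nat \<Rightarrow> 'a \<Rightarrow> 'a"
    and \<alpha> \<gamma> :: "nat \<Rightarrow> real"
    and x u p :: 'a
    and xs :: "nat \<Rightarrow> 'a"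
    and M :: nat
  assumes "w_hyperbolic W"
    and "w_convex W C"
    and nonexpansive: "\<And>n. 1-lipschitz_on UNIV (T n)"
    and "(\<Inter>n. Fix (T n)) \<noteq> {}"
    and "\<And>n. \<alpha> n = 1 - 2 / (real n + 2)"
    and "\<And>n. \<gamma> n = (real n + 2) / (real n + 1)"
    and "\<And>y n m. dist (T n y) (T m y) \<le> \<bar>\<gamma> n - \<gamma> m\<bar> / \<gamma> n * dist y (T n y)"
    and "x \<in> C" and "u \<in> C"
    and "xs 0 = x"
    and "\<And>n. xs (Suc n) = W u (T n (xs n)) (\<alpha> n)"
    and "p \<in> (\<Inter>n. Fix (T n))"
    and "M > 0"
    and "real M \<ge> max (dist x p) (dist u p)"
  shows "\<forall>m n. dist (xs (Suc n)) (xs n) \<le> 6 * real M / (real n + 2)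
           \<and> dist (xs n) (T n (xs n)) \<le> 10 * real M / (real n + 2)
           \<and> dist (xs n) (T m (xs n)) \<le> 20 * real M / (real n + 2)"
proof -
  interpret w_hyperbolic W by fact
  note T_close = assms(7) and xs_Suc = assms(11)
  have \<alpha>: "\<alpha> n = real n / (real n + 2)" for n
    using assms(5)[of n] by (simp add: field_simps)
  have \<alpha>_in: "\<alpha> n \<in> {0..1}" for n
    by (simp add: \<alpha>)
  have Tp: "T n p = p" for n
    using assms(12) by (auto simp: Fix_def)
  have T_nonexp: "dist (T n a) (T n b) \<le> dist a b" for n a b
    using lipschitz_onD[OF nonexpansive, of a b n] by simp
  have up: "dist u p \<le> M" and xp: "dist x p \<le> M"
    using assms(14) by auto
  have xs_p: "dist (xs n) p \<le> M" for n
  proof (induction n)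
    case 0
    then show ?case using xp assms(10) by simp
  next
    case (Suc n)
    then have "dist (T n (xs n)) p \<le> M"
      using T_nonexp[of n "xs n" p] by (simp add: Tp)
    then show ?case
      unfolding xs_Suc using \<alpha>_in up by (intro dist_W_le)
  qed
  have Txs_p: "dist (T m (xs n)) p \<le> M" for m n
    using T_nonexp[of m "xs n" p] xs_p[of n] by (simp add: Tp)
  \<comment> \<open>Any two points of the ball of radius \<open>M\<close> around \<open>p\<close>
    are at most \<open>2 * M\<close> apart.\<close>
  have u_Txs: "dist u (T m (xs n)) \<le> 2 * M" for m n
    using dist_triangle2[of u "T m (xs n)" p] up Txs_p[of m n] by simp
  have xs_Txs: "dist (xs n) (T m (xs n)) \<le> 2 * M" for m n
    using dist_triangle2[of "xs n" "T m (xs n)" p] xs_p[of n] Txs_p[of m n] by simp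

  have step: "dist (xs (Suc n)) (xs n) \<le> 6 * real M / (real n + 2)" for n
  proof (induction n)
    case 0
    \<comment> \<open>Since \<open>\<alpha> 0 = 0\<close>, the first iterate is the anchor
      \<open>u\<close> itself. The resulting bound \<open>2 * M\<close> is below the required 6M/2 =
      3M.\<close>
    have "dist u (xs 1) = 0"
      using W1[of 0 u u "T 0 (xs 0)"] xs_Suc[of 0] by (simp add: \<alpha>)
    then have "dist (xs 1) (xs 0) \<le> 2 * M"
      using dist_triangle2[of u x p] up xp assms(10) by auto
    then show ?case by simp
  next
    case (Suc n)
    let ?d = "dist (xs (Suc n)) (xs n)"
    \<comment> \<open>This quotient controls the change of index from \<open>T n\<close> to
      \<open>T (Suc n)\<close> at one point; its quadratic decay is what the linear rate
      requires.\<close>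
    have "\<bar>\<gamma> n - \<gamma> (Suc n)\<bar> / \<gamma> n = 1 / (real n + 2)\<^sup>2"
    proof -
      have "\<gamma> n - \<gamma> (Suc n) = 1 / ((real n + 1) * (real n + 2))"
        unfolding assms(6) by (simp add: divide_simps) (simp add: algebra_simps)
      then show ?thesis
        by (simp add: assms(6) power2_eq_square)
    qed
    then have "dist (T n (xs n)) (T (Suc n) (xs n)) \<le> 1 / (real n + 2)\<^sup>2 * (2 * M)"
      using T_close[where n=n and m="Suc n" and y="xs n"] xs_Txs[of n n]
      by (smt (verit) mult_left_mono zero_le_divide_1_iff zero_le_power2)
    \<comment> \<open>Through \<open>T (Suc n) (xs n)\<close>: the argument changes first, by
      nonexpansiveness, and then the index.\<close>
    then have T_step: "dist (T (Suc n) (xs (Suc n))) (T n (xs n)) \<le> ?d + 2 * M / (real n + 2)\<^sup>2"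
      using T_nonexp[of "Suc n" "xs (Suc n)" "xs n"]
        dist_triangle2[of "T (Suc n) (xs (Suc n))" "T n (xs n)" "T (Suc n) (xs n)"] by simp
    have \<alpha>_step: "\<bar>\<alpha> (Suc n) - \<alpha> n\<bar> = 2 / ((real n + 2) * (real n + 3))"
    proof -
      have "\<alpha> (Suc n) - \<alpha> n = 2 / ((real n + 2) * (real n + 3))"
        unfolding \<alpha> by (simp add: divide_simps) (simp add: algebra_simps)
      then show ?thesis by simp
    qed
    have "dist (xs (Suc (Suc n))) (xs (Suc n))
        \<le> \<alpha> (Suc n) * dist (T (Suc n) (xs (Suc n))) (T n (xs n))
          + \<bar>\<alpha> (Suc n) - \<alpha> n\<bar> * dist u (T n (xs n))"
      unfolding xs_Suc[of "Suc n"] unfolding xs_Suc[of n]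
      by (rule dist_W_same_left_le[OF \<alpha>_in \<alpha>_in])
    also have "\<dots> \<le> \<alpha> (Suc n) * (?d + 2 * M / (real n + 2)\<^sup>2)
          + \<bar>\<alpha> (Suc n) - \<alpha> n\<bar> * (2 * M)"
      using \<alpha>_in[of "Suc n"] T_step u_Txs[of n n] by (intro add_mono mult_left_mono) auto
    also have "\<dots> = (real n + 1) / (real n + 3) * (?d + 2 * M / (real n + 2)\<^sup>2)
          + 4 * M / ((real n + 2) * (real n + 3))"
      unfolding \<alpha>_step by (simp add: \<alpha> add.commute)
    finally show ?case
      using linear_rate_step[OF _ _ Suc] by (simp add: add.commute)
  qed

  have own: "dist (xs n) (T n (xs n)) \<le> 10 * real M / (real n + 2)" for n
  proof -
    \<comment> \<open>The next iterate is close to \<open>T n (xs n)\<close>, as the anchor has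
      weight only 2/(n+2). This yields 4M/(n+2), and 10 = 6 + 4.\<close>
    have "dist (xs (Suc n)) (T n (xs n)) \<le> (1 - \<alpha> n) * dist u (T n (xs n))"
      unfolding xs_Suc by (rule dist_W_right_le[OF \<alpha>_in])
    also have "\<dots> \<le> (1 - \<alpha> n) * (2 * M)"
      using \<alpha>_in[of n] u_Txs by (intro mult_left_mono) auto
    also have "\<dots> = 4 * real M / (real n + 2)"
      by (simp add: assms(5))
    finally have "dist (xs n) (T n (xs n)) \<le> 6 * real M / (real n + 2) + 4 * real M / (real n + 2)"
      using step[of n] dist_triangle3[of "xs n" "T n (xs n)" "xs (Suc n)"] by linarith
    then show ?thesis by (simp add: add_divide_distrib[symmetric])
  qed

  have "dist (xs n) (T m (xs n)) \<le> 20 * real M / (real n + 2)" for m n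
  proof -
    have \<gamma>: "\<gamma> k = 1 + 1 / (real k + 1)" for k
      unfolding assms(6) by (simp add: field_simps)
    have \<gamma>_bounds: "1 \<le> \<gamma> k" "\<gamma> k \<le> 2" for k
      by (simp_all add: \<gamma>)
    \<comment> \<open>All values of \<open>\<gamma>\<close> lie in [1,2], so they differ by at most
      1, hence by at most \<open>\<gamma> n\<close>. Exchanging \<open>T n\<close> for
      \<open>T m\<close> therefore at most doubles the displacement of \<open>xs n\<close>, whence
      20 = 2 * 10.\<close>
    have "\<bar>\<gamma> n - \<gamma> m\<bar> / \<gamma> n \<le> 1"
      using \<gamma>_bounds[of n] \<gamma>_bounds[of m] by (simp add: abs_if)
    then have "\<bar>\<gamma> n - \<gamma> m\<bar> / \<gamma> n * dist (xs n) (T n (xs n)) \<le> dist (xs n) (T n (xs n))"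
      using \<gamma>_bounds[of n] by (intro mult_left_le_one_le) auto
    then have "dist (xs n) (T m (xs n)) \<le> 2 * dist (xs n) (T n (xs n))"
      using T_close[where n=n and m=m and y="xs n"]
        dist_triangle[of "xs n" "T m (xs n)" "T n (xs n)"] by linarith
    then show ?thesis using own[of n] by linarith
  qed
  with step own show ?thesis by blast
qed

end
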